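(* Let $G$ be a graph and let $\mathbf{x}=(x_w)_{w\in V(G)}$ be a positive unit eigenvector (all entries positive, Euclidean norm $1$) of $Q(G)$ corresponding to $q(G)$. Let $u,v\in V(G)$ be distinct vertices with $uv\notin E(G)$ and $N_G(u)\neq N_G(v)$, and let $G'$ be the graph obtained from $G$ by deleting all edges incident with $v$ and then adding all edges between $v$ and $N_G(u)$. If $$\sum_{w\in N_{G}(u)}(x_{w}+x_{u})^{2}-q(G)\, x_{u}^{2}\ \ge\ \sum_{w\in N_{G}(v)}(x_{w}+x_{v})^{2}-q(G)\, x_{v}^{2},$$ then $q(G')>q(G)$.
   Context: All graphs are finite and simple. $N_G(v)$ is the set of neighbours of $v$ in $G$. The signless Laplacian matrix is $Q(G)=D(G)+A(G)$, where $D(G)$ is the diagonal degree matrix and $A(G)$ the adjacency matrix; $q(G)$ is its largest eigenvalue. *)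

theory Defs
  imports "HOL-Analysis.Analysis"
begin

text \<open>A graph on the vertex set \<open>UNIV :: 'n set\<close>, for an arbitrary finite type \<open>'n\<close>, is given by
  its set of edges.\<close>

definition simple_graph :: "'n::finite set set \<Rightarrow> bool" where
  "simple_graph E \<longleftrightarrow> (\<forall>e\<in>E. card e = 2)"

definition neighbours :: "'n::finite set set \<Rightarrow> 'n \<Rightarrow> 'n set" where
  "neighbours E v = {w. {v, w} \<in> E}"

definition degree_matrix :: "'n::finite set set \<Rightarrow> real^'n^'n" where
  "degree_matrix E = (\<chi> i j. if i = j then real (card (neighbours E i)) else 0)"

definition adjacency_matrix :: "'n::finite set set \<Rightarrow> real^'n^'n" where
  "adjacency_matrix E = (\<chi> i j. if {i, j} \<in> E then 1 else 0)"

definition signless_laplacian :: "'n::finite set set \<Rightarrow> real^'n^'n" where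
  "signless_laplacian E = degree_matrix E + adjacency_matrix E"

definition eigenvector :: "real^'n^'n \<Rightarrow> real^'n \<Rightarrow> real \<Rightarrow> bool" where
  "eigenvector A x k \<longleftrightarrow> x \<noteq> 0 \<and> A *v x = k *\<^sub>R x"

definition eigenvalues :: "real^'n^'n \<Rightarrow> real set" where
  "eigenvalues A = {k. \<exists>x. eigenvector A x k}"

text \<open>The maximum is attained, as \<open>finite_eigenvalues\<close>, \<open>eigenvalues_nonempty\<close> and
  \<open>transpose_signless_laplacian\<close> below show. Since the matrix is symmetric, all its eigenvalues
  are real.\<close>

definition signless_spectral_radius :: "'n::finite set set \<Rightarrow> real" where
  "signless_spectral_radius E = Max (eigenvalues (signless_laplacian E))"

definition rewire :: "'n::finite set set \<Rightarrow> 'n \<Rightarrow> 'n \<Rightarrow> 'n set set" where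
  "rewire E u v = {e \<in> E. v \<notin> e} \<union> {{v, w} | w. w \<in> neighbours E u}"

lemma simple_graph_rewire:
  assumes "simple_graph E" "{u, v} \<notin> E"
  shows "simple_graph (rewire E u v)"
  using assms by (auto simp: simple_graph_def rewire_def neighbours_def card_2_iff)

lemma transpose_signless_laplacian:
  "transpose (signless_laplacian E) = signless_laplacian E"
  by (auto simp: transpose_def signless_laplacian_def degree_matrix_def adjacency_matrix_def
      vec_eq_iff insert_commute)

lemma symmetric_inner:
  fixes A :: "real^'n^'n"
  assumes "transpose A = A"
  shows "x \<bullet> (A *v y) = (A *v x) \<bullet> y"
  by (metis assms dot_lmul_matrix transpose_matrix_vector)

lemma finite_eigenvalues:
  fixes A :: "real^'n^'n"
  assumes "transpose A = A"
  shows "finite (eigenvalues A)"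
proof -
  have "\<forall>k\<in>eigenvalues A. \<exists>x. eigenvector A x k"
    by (auto simp: eigenvalues_def)
  then obtain f where f: "\<And>k. k \<in> eigenvalues A \<Longrightarrow> eigenvector A (f k) k"
    by metis
  have orth: "f k \<bullet> f l = 0" if "k \<in> eigenvalues A" "l \<in> eigenvalues A" "k \<noteq> l" for k l
  proof -
    have "l * (f k \<bullet> f l) = k * (f k \<bullet> f l)"
      using symmetric_inner[OF assms, of "f k" "f l"] f[OF that(1)] f[OF that(2)]
      by (simp add: eigenvector_def)
    then show ?thesis using that(3) by simp
  qed
  have nz: "f k \<noteq> 0" if "k \<in> eigenvalues A" for k
    using f[OF that] by (simp add: eigenvector_def)
  have inj: "inj_on f (eigenvalues A)"
    by (rule inj_onI) (metis orth nz inner_eq_zero_iff)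
  have "pairwise orthogonal (f ` eigenvalues A)"
    by (auto simp: pairwise_def orthogonal_def intro!: orth)
  then have "independent (f ` eigenvalues A)"
    by (rule pairwise_orthogonal_independent) (use nz in auto)
  then have "finite (f ` eigenvalues A)"
    using independent_bound by blast
  then show ?thesis
    using inj by (rule finite_imageD)
qed

lemma eigenvalues_nonempty:
  fixes A :: "real^'n^'n"
  assumes sym: "transpose A = A"
  shows "eigenvalues A \<noteq> {}"
proof -
  define g where "g x = x \<bullet> (A *v x)" for x
  have cont: "continuous_on (sphere 0 1) g"
    unfolding g_def by (intro continuous_intros)
  have ne: "sphere (0::real^'n) 1 \<noteq> {}" by simp
  obtain x where x: "norm x = 1" and max: "\<And>y. norm y = 1 \<Longrightarrow> g y \<le> g x"
    using continuous_attains_sup[OF compact_sphere ne cont] by auto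
  define B where "B y = g x *\<^sub>R y - A *v y" for y
  have B_nonneg: "y \<bullet> B y \<ge> 0" for y
  proof (cases "y = 0")
    case False
    have "g (y /\<^sub>R norm y) \<le> g x" using False by (intro max) simp
    then have "y \<bullet> (A *v y) \<le> g x * (norm y)\<^sup>2"
      using False by (simp add: g_def matrix_vector_mult_scaleR field_simps power2_eq_square)
    then show ?thesis
      by (simp add: B_def inner_diff_right power2_norm_eq_inner)
  qed (simp add: B_def)
  have Bx: "x \<bullet> B x = 0"
    using x by (simp add: B_def g_def inner_diff_right flip: power2_norm_eq_inner)
  have "y \<bullet> B x = 0" for y
  proof -
    have sw: "x \<bullet> B y = y \<bullet> B x"
      using symmetric_inner[OF sym, of x y] by (simp add: B_def inner_diff_right inner_commute)
    have exp: "0 \<le> 2 * t * (y \<bullet> B x) + t\<^sup>2 * (y \<bullet> B y)" for t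
    proof -
      have "B (x + t *\<^sub>R y) = B x + t *\<^sub>R B y"
        by (simp add: B_def matrix_vector_right_distrib matrix_vector_mult_scaleR algebra_simps)
      then show ?thesis
        using B_nonneg[of "x + t *\<^sub>R y"] Bx sw
        by (simp add: inner_add_left inner_add_right power2_eq_square algebra_simps)
    qed
    define b c where "b = y \<bullet> B x" and "c = y \<bullet> B y"
    have c: "c \<ge> 0" unfolding c_def by (rule B_nonneg)
    have "0 \<le> 2 * (- b / (c + 1)) * b + (- b / (c + 1))\<^sup>2 * c"
      using exp[of "- b / (c + 1)"] by (simp add: b_def c_def)
    also have "\<dots> = - (b\<^sup>2 * (c + 2)) / (c + 1)\<^sup>2"
      using c by (simp add: divide_simps) (simp add: power2_eq_square algebra_simps)
    finally have "b\<^sup>2 * (c + 2) \<le> 0"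
      using c by (simp add: divide_simps split: if_splits)
    then have "b = 0" using c by (simp add: mult_le_0_iff)
    then show ?thesis by (simp add: b_def)
  qed
  then have "B x = 0" using inner_eq_zero_iff by blast
  then have "eigenvector A x (g x)"
    using x by (auto simp: eigenvector_def B_def)
  then show ?thesis by (auto simp: eigenvalues_def)
qed

end

theory Submission
  imports Defs
begin

text \<open>Let \<open>y\<close> agree with \<open>x\<close> except that \<open>y\<^sub>v = x\<^sub>u\<close>. Writing the quadratic form of the signless
  Laplacian as a sum of squares over the edges, the hypothesis says exactly that the Rayleigh
  quotient of \<open>y\<close> for \<open>G'\<close> is at least \<open>q(G)\<close>. If \<open>q(G') \<le> q(G)\<close>, then \<open>y\<close> maximises
  the Rayleigh quotient, so it is an eigenvector of \<open>Q(G')\<close> for \<open>q(G)\<close>. The eigenvalue equations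
  of \<open>x\<close> and \<open>y\<close> then contradict each other at any vertex in which \<open>N\<^sub>G(u)\<close> and \<open>N\<^sub>G(v)\<close> differ,
  because its neighbourhood gains or loses exactly \<open>v\<close>.\<close>

text \<open>The form is nonnegative and vanishes at \<open>x\<close>, so \<open>x\<close> minimises
  it and its first variation there is zero in every direction. Testing the single direction
  \<open>B *v x\<close> suffices: the variation is then a multiple of the squared norm of
  \<open>B *v x\<close>.\<close>

lemma psd_null_vector:
  fixes B :: "real^'n^'n"
  assumes sym: "transpose B = B"
    and psd: "\<And>y. 0 \<le> y \<bullet> (B *v y)"
    and null: "x \<bullet> (B *v x) = 0"
  shows "B *v x = 0"
proof -
  define y where "y = B *v x"
  define c where "c = y \<bullet> (B *v y)"
  have c: "0 \<le> c"
    unfolding c_def by (rule psd)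
  have sw: "x \<bullet> (B *v y) = y \<bullet> y"
    using symmetric_inner[OF sym, of x y] by (simp add: y_def)
  have nonneg: "0 \<le> t\<^sup>2 * c - 2 * t * (y \<bullet> y)" for t
  proof -
    have "B *v (x - t *\<^sub>R y) = y - t *\<^sub>R (B *v y)"
      by (simp add: y_def matrix_vector_mult_diff_distrib matrix_vector_mult_scaleR)
    then show ?thesis
      using psd[of "x - t *\<^sub>R y"] null sw
      by (simp add: c_def y_def[symmetric] inner_diff_left inner_diff_right power2_eq_square
          algebra_simps)
  qed
  define b where "b = y \<bullet> y"
  \<comment> \<open>For \<open>c > 0\<close> the quadratic in \<open>t\<close> is smallest at
    \<open>b / c\<close>; the denominator \<open>c + 1\<close> also covers \<open>c = 0\<close> and
    still makes the value negative unless \<open>b = 0\<close>.\<close>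
  have "0 \<le> (b / (c + 1))\<^sup>2 * c - 2 * (b / (c + 1)) * b"
    unfolding b_def by (rule nonneg)
  also have "\<dots> = - (b\<^sup>2 * (c + 2)) / (c + 1)\<^sup>2"
    using c by (simp add: divide_simps) (simp add: power2_eq_square algebra_simps)
  finally have "b\<^sup>2 * (c + 2) \<le> 0"
    using c by (simp add: divide_simps split: if_splits)
  then have "b = 0"
    using c by (simp add: mult_le_0_iff)
  then have "y = 0"
    by (simp add: b_def)
  then show ?thesis
    by (simp add: y_def)
qed

lemma scalar_minus_matrix_mult:
  fixes A :: "real^'n^'n"
  shows "(m *\<^sub>R mat 1 - A) *v y = m *\<^sub>R y - A *v y"
  by (simp add: matrix_vector_mult_diff_rdistrib scaleR_matrix_vector_assoc[symmetric])

text \<open>By \<open>bound\<close> the matrix \<open>m *\<^sub>R mat 1 - A\<close> is positive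
  semidefinite, and by \<open>eq\<close> its quadratic form vanishes at \<open>x\<close>.\<close>

lemma rayleigh_maximiser:
  fixes A :: "real^'n^'n"
  assumes sym: "transpose A = A"
    and bound: "\<And>y. y \<bullet> (A *v y) \<le> m * (y \<bullet> y)"
    and eq: "x \<bullet> (A *v x) = m * (x \<bullet> x)"
  shows "A *v x = m *\<^sub>R x"
proof -
  have "(m *\<^sub>R mat 1 - A) *v x = 0"
  proof (rule psd_null_vector)
    show "transpose (m *\<^sub>R mat 1 - A) = m *\<^sub>R mat 1 - A"
      using sym by (auto simp: transpose_def vec_eq_iff mat_def)
  qed (use bound eq in \<open>simp_all add: scalar_minus_matrix_mult inner_diff_right\<close>)
  then show ?thesis
    by (simp add: scalar_minus_matrix_mult)
qed

text \<open>By compactness the form attains a maximum \<open>m\<close> on the unit sphere, and by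
  homogeneity \<open>m\<close> bounds the Rayleigh quotient everywhere. The maximiser is then an
  eigenvector for \<open>m\<close>, so \<open>m\<close> is at most the largest eigenvalue.\<close>

lemma rayleigh_le_Max_eigenvalues:
  fixes A :: "real^'n^'n"
  assumes sym: "transpose A = A"
  shows "y \<bullet> (A *v y) \<le> Max (eigenvalues A) * (y \<bullet> y)"
proof -
  have cont: "continuous_on (sphere 0 1) (\<lambda>x. x \<bullet> (A *v x))"
    by (intro continuous_intros)
  have ne: "sphere (0::real^'n) 1 \<noteq> {}" by simp
  obtain x where x: "norm x = 1"
    and max: "\<And>y. norm y = 1 \<Longrightarrow> y \<bullet> (A *v y) \<le> x \<bullet> (A *v x)"
    using continuous_attains_sup[OF compact_sphere ne cont] by auto
  define m where "m = x \<bullet> (A *v x)"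
  have bound: "y \<bullet> (A *v y) \<le> m * (y \<bullet> y)" for y
  proof (cases "y = 0")
    case False
    then show ?thesis
      using max[of "y /\<^sub>R norm y"]
      by (simp add: m_def matrix_vector_mult_scaleR field_simps power2_eq_square
          flip: power2_norm_eq_inner)
  qed simp
  have xx: "x \<bullet> x = 1"
    using x by (simp flip: power2_norm_eq_inner)
  have "A *v x = m *\<^sub>R x"
    by (rule rayleigh_maximiser[OF sym bound]) (simp add: m_def xx)
  moreover have "x \<noteq> 0"
    using x by auto
  ultimately have "m \<in> eigenvalues A"
    by (auto simp: eigenvalues_def eigenvector_def)
  then have "m \<le> Max (eigenvalues A)"
    using finite_eigenvalues[OF sym] by simp
  then have "m * (y \<bullet> y) \<le> Max (eigenvalues A) * (y \<bullet> y)"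
    by (intro mult_right_mono) auto
  with bound show ?thesis
    by (rule order_trans)
qed

lemma simple_graph_loopless: "simple_graph E \<Longrightarrow> {v} \<notin> E"
  by (auto simp: simple_graph_def)

lemma sum_incident_edges:
  fixes f :: "'n::finite set \<Rightarrow> 'a::comm_monoid_add"
  assumes "simple_graph E"
  shows "(\<Sum>e | e \<in> E \<and> v \<in> e. f e) = (\<Sum>w\<in>neighbours E v. f {v, w})"
proof (rule sum.reindex_cong)
  show "inj_on (\<lambda>w. {v, w}) (neighbours E v)"
    by (auto simp: inj_on_def doubleton_eq_iff)
  show "{e. e \<in> E \<and> v \<in> e} = (\<lambda>w. {v, w}) ` neighbours E v"
  proof (intro equalityI subsetI)
    fix e assume e: "e \<in> {e. e \<in> E \<and> v \<in> e}"
    then obtain a b where "e = {a, b}"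
      using assms by (auto simp: simple_graph_def card_2_iff)
    with e obtain w where "e = {v, w}"
      by auto
    with e show "e \<in> (\<lambda>w. {v, w}) ` neighbours E v"
      by (simp add: neighbours_def)
  qed (auto simp: neighbours_def)
qed simp

lemma signless_laplacian_mult_nth:
  assumes "simple_graph E"
  shows "(signless_laplacian E *v z) $ i = (\<Sum>w\<in>neighbours E i. z $ i + z $ w)"
proof -
  have "(adjacency_matrix E *v z) $ i = (\<Sum>w\<in>UNIV. if w \<in> neighbours E i then z $ w else 0)"
    by (auto simp: matrix_vector_mult_def adjacency_matrix_def neighbours_def intro!: sum.cong)
  also have "\<dots> = (\<Sum>w\<in>neighbours E i. z $ w)"
    by (simp add: sum.If_cases)
  finally have adj: "(adjacency_matrix E *v z) $ i = (\<Sum>w\<in>neighbours E i. z $ w)" .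
  have deg: "(degree_matrix E *v z) $ i = real (card (neighbours E i)) * z $ i"
    by (simp add: matrix_vector_mult_def degree_matrix_def if_distrib[of "\<lambda>a. a * _"] cong: if_cong)
  show ?thesis
    by (simp add: signless_laplacian_def matrix_vector_mult_add_rdistrib adj deg sum.distrib)
qed

text \<open>Entry \<open>i\<close> of the product is the sum, over the edges at \<open>i\<close>, of
  the total weight of each edge. Exchanging vertices and edges then gives each edge its total weight
  once per endpoint, multiplied by the weight of that endpoint.\<close>

lemma signless_laplacian_quadratic_form:
  assumes "simple_graph E"
  shows "z \<bullet> (signless_laplacian E *v z) = (\<Sum>e\<in>E. (\<Sum>i\<in>e. z $ i)\<^sup>2)"
proof -
  have nth: "(signless_laplacian E *v z) $ i = (\<Sum>e | e \<in> E \<and> i \<in> e. \<Sum>j\<in>e. z $ j)" for i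
    unfolding signless_laplacian_mult_nth[OF assms] sum_incident_edges[OF assms]
  proof (rule sum.cong)
    fix w assume "w \<in> neighbours E i"
    then have "i \<noteq> w"
      using simple_graph_loopless[OF assms] by (auto simp: neighbours_def)
    then show "z $ i + z $ w = (\<Sum>j\<in>{i, w}. z $ j)" by simp
  qed simp
  have "z \<bullet> (signless_laplacian E *v z)
      = (\<Sum>i\<in>UNIV. \<Sum>e | e \<in> E \<and> i \<in> e. z $ i * (\<Sum>j\<in>e. z $ j))"
    by (simp add: inner_vec_def nth sum_distrib_left)
  also have "\<dots> = (\<Sum>e\<in>E. \<Sum>i | i \<in> UNIV \<and> i \<in> e. z $ i * (\<Sum>j\<in>e. z $ j))"
    by (rule sum.swap_restrict) auto
  also have "\<dots> = (\<Sum>e\<in>E. (\<Sum>i\<in>e. z $ i)\<^sup>2)"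
    by (simp add: power2_eq_square sum_distrib_right)
  finally show ?thesis .
qed

text \<open>Separates the edges at \<open>v\<close>, the only ones that rewiring changes.\<close>

lemma signless_laplacian_quadratic_form_split:
  assumes "simple_graph E"
  shows "z \<bullet> (signless_laplacian E *v z)
    = (\<Sum>e | e \<in> E \<and> v \<notin> e. (\<Sum>i\<in>e. z $ i)\<^sup>2) + (\<Sum>w\<in>neighbours E v. (z $ w + z $ v)\<^sup>2)"
proof -
  have "(\<Sum>e\<in>E. (\<Sum>i\<in>e. z $ i)\<^sup>2)
      = (\<Sum>e | e \<in> E \<and> v \<notin> e. (\<Sum>i\<in>e. z $ i)\<^sup>2) + (\<Sum>e | e \<in> E \<and> v \<in> e. (\<Sum>i\<in>e. z $ i)\<^sup>2)"
    using sum.Int_Diff[of E _ "{e. v \<notin> e}"] by (simp add: Int_def set_diff_eq)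
  also have "(\<Sum>e | e \<in> E \<and> v \<in> e. (\<Sum>i\<in>e. z $ i)\<^sup>2)
      = (\<Sum>w\<in>neighbours E v. (z $ w + z $ v)\<^sup>2)"
    unfolding sum_incident_edges[OF assms]
  proof (rule sum.cong)
    fix w assume "w \<in> neighbours E v"
    then have "v \<noteq> w"
      using simple_graph_loopless[OF assms] by (auto simp: neighbours_def)
    then show "(\<Sum>i\<in>{v, w}. z $ i)\<^sup>2 = (z $ w + z $ v)\<^sup>2"
      by (simp add: add.commute)
  qed simp
  finally show ?thesis
    by (simp add: signless_laplacian_quadratic_form[OF assms])
qed

lemma neighbours_rewire_self: "neighbours (rewire E u v) v = neighbours E u"
  by (auto simp: neighbours_def rewire_def doubleton_eq_iff)

lemma neighbours_rewire_other:
  assumes "w \<noteq> v"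
  shows "neighbours (rewire E u v) w
    = (if w \<in> neighbours E u then insert v (neighbours E w) else neighbours E w - {v})"
  using assms by (auto simp: neighbours_def rewire_def doubleton_eq_iff)

theorem lemma2p8:
  fixes E :: "'n::finite set set" and x :: "real^'n" and u v :: 'n
  assumes "simple_graph E"
    and "eigenvector (signless_laplacian E) x (signless_spectral_radius E)"
    and "\<forall>w. x $ w > 0"
    and "norm x = 1"
    and "u \<noteq> v"
    and "{u, v} \<notin> E"
    and "neighbours E u \<noteq> neighbours E v"
    and "(\<Sum>w\<in>neighbours E u. (x $ w + x $ u)\<^sup>2) - signless_spectral_radius E * (x $ u)\<^sup>2
       \<ge> (\<Sum>w\<in>neighbours E v. (x $ w + x $ v)\<^sup>2) - signless_spectral_radius E * (x $ v)\<^sup>2"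
  shows "signless_spectral_radius (rewire E u v) > signless_spectral_radius E"
proof (rule ccontr)
  define E' where "E' = rewire E u v"
  define q where "q = signless_spectral_radius E"
  define y where "y = (\<chi> w. if w = v then x $ u else x $ w)"
  have y_v: "y $ v = x $ u" and y_other: "\<And>w. w \<noteq> v \<Longrightarrow> y $ w = x $ w"
    by (simp_all add: y_def)
  have E': "simple_graph E'"
    unfolding E'_def by (rule simple_graph_rewire) (use assms in auto)
  note sym = transpose_signless_laplacian[of E']
  assume "\<not> ?thesis"
  then have le: "Max (eigenvalues (signless_laplacian E')) \<le> q"
    by (simp add: E'_def q_def signless_spectral_radius_def)
  have bound: "z \<bullet> (signless_laplacian E' *v z) \<le> q * (z \<bullet> z)" for z
    by (rule order_trans[OF rayleigh_le_Max_eigenvalues[OF sym]])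
      (intro mult_right_mono le inner_ge_zero)
  have Qx: "signless_laplacian E *v x = q *\<^sub>R x"
    using assms(2) by (simp add: eigenvector_def q_def)

  have rest: "(\<Sum>e | e \<in> E' \<and> v \<notin> e. (\<Sum>i\<in>e. y $ i)\<^sup>2) = (\<Sum>e | e \<in> E \<and> v \<notin> e. (\<Sum>i\<in>e. x $ i)\<^sup>2)"
  proof (rule sum.cong)
    fix e assume "e \<in> {e. e \<in> E \<and> v \<notin> e}"
    then have "(\<Sum>i\<in>e. y $ i) = (\<Sum>i\<in>e. x $ i)"
      by (intro sum.cong y_other) auto
    then show "(\<Sum>i\<in>e. y $ i)\<^sup>2 = (\<Sum>i\<in>e. x $ i)\<^sup>2" by simp
  qed (auto simp: E'_def rewire_def)
  \<comment> \<open>The new neighbours of \<open>v\<close> are those of \<open>u\<close>. As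
    \<open>u\<close> and \<open>v\<close> are not adjacent, \<open>v\<close> is not among them, so
    \<open>y\<close> agrees with \<open>x\<close> on all of them.\<close>
  have star: "(\<Sum>w\<in>neighbours E' v. (y $ w + y $ v)\<^sup>2) = (\<Sum>w\<in>neighbours E u. (x $ w + x $ u)\<^sup>2)"
    unfolding E'_def neighbours_rewire_self y_v
  proof (rule sum.cong)
    fix w assume "w \<in> neighbours E u"
    then have "w \<noteq> v"
      using assms(6) by (auto simp: neighbours_def)
    then show "(y $ w + x $ u)\<^sup>2 = (x $ w + x $ u)\<^sup>2"
      by (simp add: y_other)
  qed simp
  have "y \<bullet> y - (y $ v)\<^sup>2 = x \<bullet> x - (x $ v)\<^sup>2"
    by (simp add: inner_vec_def power2_eq_square sum.remove[of UNIV v] y_other)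
  then have norm_y: "y \<bullet> y = x \<bullet> x - (x $ v)\<^sup>2 + (x $ u)\<^sup>2"
    by (simp add: y_v)
  \<comment> \<open>Passing from \<open>x\<close> on \<open>E\<close> to \<open>y\<close> on
    \<open>E'\<close> changes the form by the star sum at \<open>u\<close> minus the star sum at
    \<open>v\<close>, and \<open>q\<close> times the squared norm by
    \<open>q * ((x $ u)\<^sup>2 - (x $ v)\<^sup>2)\<close>. The hypothesis says that the first
    change is at least the second.\<close>
  have "q * (x \<bullet> x) = x \<bullet> (signless_laplacian E *v x)"
    by (simp add: Qx)
  then have "q * (y \<bullet> y) \<le> y \<bullet> (signless_laplacian E' *v y)"
    using assms(8)
    unfolding norm_y signless_laplacian_quadratic_form_split[OF E', of _ v]
      signless_laplacian_quadratic_form_split[OF assms(1), of _ v] rest star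
    by (simp add: q_def[symmetric] algebra_simps)
  then have Qy: "signless_laplacian E' *v y = q *\<^sub>R y"
    by (intro rayleigh_maximiser[OF sym bound] antisym bound)

  obtain w where w: "w \<in> neighbours E u \<longleftrightarrow> w \<notin> neighbours E v"
    using assms(7) by blast
  \<comment> \<open>\<open>v\<close> lies in neither neighbourhood: it is not adjacent to
    \<open>u\<close>, and there are no loops. Hence \<open>x\<close> and \<open>y\<close> agree at
    \<open>w\<close>, and their eigenvalue equations there have the same right-hand side.\<close>
  have "w \<noteq> v"
    using w assms(6) simple_graph_loopless[OF assms(1)] by (auto simp: neighbours_def)
  have adj: "v \<in> neighbours E w \<longleftrightarrow> w \<in> neighbours E v"
    by (simp add: neighbours_def insert_commute)
  have pos: "0 < x $ i" for i
    using assms(3) by blast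
  let ?S = "\<Sum>z\<in>neighbours E w - {v}. x $ w + x $ z"
  have S: "(\<Sum>z\<in>neighbours E w - {v}. y $ w + y $ z) = ?S"
    using \<open>w \<noteq> v\<close> by (intro sum.cong) (auto simp: y_other)
  have sum_x: "(\<Sum>z\<in>neighbours E w. x $ w + x $ z) = q * x $ w"
    using arg_cong[OF Qx, of "\<lambda>a. a $ w"] by (simp add: signless_laplacian_mult_nth[OF assms(1)])
  have sum_y: "(\<Sum>z\<in>neighbours E' w. y $ w + y $ z) = q * x $ w"
    using arg_cong[OF Qy, of "\<lambda>a. a $ w"] \<open>w \<noteq> v\<close>
    by (simp add: signless_laplacian_mult_nth[OF E'] y_other)
  show False
  \<comment> \<open>Both equations at \<open>w\<close> share the sum \<open>?S\<close> over
    neighbours other than \<open>v\<close>. If \<open>w\<close> gains \<open>v\<close>, the equation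
    for \<open>y\<close> has the extra term \<open>x $ w + x $ u\<close>; if \<open>w\<close> loses
    \<open>v\<close>, the equation for \<open>x\<close> has the extra term
    \<open>x $ w + x $ v\<close>. Either extra term is positive.\<close>
  proof (cases "w \<in> neighbours E u")
    case True
    then have "v \<notin> neighbours E w"
      using w adj by blast
    then have "?S = q * x $ w"
      using sum_x by simp
    moreover have "x $ w + x $ u + ?S = q * x $ w"
      using sum_y S True \<open>w \<noteq> v\<close> \<open>v \<notin> neighbours E w\<close>
      by (simp add: E'_def neighbours_rewire_other y_v y_other)
    ultimately show False
      using pos[of w] pos[of u] by linarith
  next
    case False
    then have "v \<in> neighbours E w"
      using w adj by blast
    then have "x $ w + x $ v + ?S = q * x $ w"
      using sum_x sum.remove[of "neighbours E w" v "\<lambda>z. x $ w + x $ z"] by simp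
    moreover have "?S = q * x $ w"
      using sum_y S False \<open>w \<noteq> v\<close> by (simp add: E'_def neighbours_rewire_other)
    ultimately show False
      using pos[of w] pos[of v] by linarith
  qed
qed

end
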